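(* Let $0<q<1$, let $N\ge1$ be an integer, and let $P_n(x)$, $n=0,1,\dots,N$, be the Sturmian sequence of polynomials on the exponential grid $x_s=q^{-s}$, $s=0,1,\dots,N$. Let $Q_n(x)=Q_n(x;q^{-N-1},q^{-N-1},N)$ be the monic $q$-Hahn polynomials with parameters $\alpha=\beta=q^{-N-1}$. Then $P_n(x)$ is the Christoffel transform of these $q$-Hahn polynomials at the point $0$: $$P_n(x)=\frac{Q_{n+1}(x)-\dfrac{Q_{n+1}(0)}{Q_n(0)}\,Q_n(x)}{x},\qquad n=0,1,\dots,N.$$
   Context: Sturmian sequence on a grid: given distinct real numbers $x_0,\dots,x_N$, put $P_{N+1}(x)=\prod_{s=0}^N(x-x_s)$ and $P_N(x)=(N+1)^{-1}P_{N+1}'(x)$. The Euclidean algorithm produces uniquely monic polynomials $P_{N-1},\dots,P_0=1$ ($\deg P_n=n$), real $b_n$ and $u_n>0$ with $P_{n+1}(x)=(x-b_n)P_n(x)-u_nP_{n-1}(x)$ for $n=1,\dots,N$, and $P_1(x)=x-b_0$. The polynomials $P_0,\dots,P_N$ form the Sturmian sequence. Monic $q$-Hahn polynomials: for $0\le n\le N$, $Q_n(x;\alpha,\beta,N)$ is the monic polynomial of degree $n$ in $x$ proportional to $${}_3\phi_2\left({q^{-n},\ \alpha\beta q^{n+1},\ x\atop q^{-N},\ \alpha q}\,\Big|\,q;q\right)=\sum_{k=0}^n\frac{(q^{-n};q)_k(\alpha\beta q^{n+1};q)_k(x;q)_k}{(q^{-N};q)_k(\alpha q;q)_k(q;q)_k}\,q^k,\qquad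 (y;q)_k=\prod_{i=0}^{k-1}(1-yq^i).$$ For $n=N+1$, $Q_{N+1}(x)=\prod_{s=0}^N(x-q^{-s})$, the monic polynomial vanishing on the whole grid. *)

theory Defs
  imports Complex_Main "HOL-Computational_Algebra.Polynomial"
begin

definition make_monic :: "real poly \<Rightarrow> real poly" where
  "make_monic p = smult (inverse (lead_coeff p)) p"

definition grid_poly :: "(nat \<Rightarrow> real) \<Rightarrow> nat \<Rightarrow> real poly" where
  "grid_poly x N = (\<Prod>s\<le>N. [:- x s, 1:])"

text \<open>The monic Euclidean algorithm started at the grid polynomial of degree \<open>N + 1\<close> and its
  normalized derivative; the index counts steps, so it runs against the degree.\<close>

fun euclid_seq :: "(nat \<Rightarrow> real) \<Rightarrow> nat \<Rightarrow> nat \<Rightarrow> real poly" where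
  "euclid_seq x N 0 = grid_poly x N"
| "euclid_seq x N (Suc 0) = smult (1 / real (N + 1)) (pderiv (grid_poly x N))"
| "euclid_seq x N (Suc (Suc k)) = make_monic (euclid_seq x N k mod euclid_seq x N (Suc k))"

text \<open>\<open>sturmian x N n\<close> is the polynomial of degree \<open>n\<close>, for \<open>n \<le> N + 1\<close>.\<close>

definition sturmian :: "(nat \<Rightarrow> real) \<Rightarrow> nat \<Rightarrow> nat \<Rightarrow> real poly" where
  "sturmian x N n = euclid_seq x N (N + 1 - n)"

text \<open>Any monic solution of the three-term recurrence with the prescribed top two members is
  \<open>sturmian x N\<close>, so the definition agrees with the characterization by the recurrence.\<close>

lemma sturmian_unique:
  fixes P :: "nat \<Rightarrow> real poly" and b u :: "nat \<Rightarrow> real"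
  assumes top: "P (N + 1) = grid_poly x N"
    and sub: "P N = smult (1 / real (N + 1)) (pderiv (grid_poly x N))"
    and monic: "\<And>n. n \<le> N \<Longrightarrow> degree (P n) = n \<and> lead_coeff (P n) = 1"
    and pos: "\<And>n. 1 \<le> n \<Longrightarrow> n \<le> N \<Longrightarrow> u n > 0"
    and rec: "\<And>n. 1 \<le> n \<Longrightarrow> n \<le> N \<Longrightarrow>
      P (n + 1) = [:- b n, 1:] * P n - smult (u n) (P (n - 1))"
    and "n \<le> N + 1"
  shows "sturmian x N n = P n"
proof -
  have step: "k \<le> N + 1 \<Longrightarrow> euclid_seq x N k = P (N + 1 - k)" for k
  proof (induction k rule: induct_nat_012)
    case (ge2 k)
    define n where "n = N - k"
    have n: "1 \<le> n" "n \<le> N" "N + 1 - k = n + 1" "N + 1 - Suc k = n"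
      "N + 1 - Suc (Suc k) = n - 1"
      using ge2.prems by (auto simp: n_def)
    have e: "euclid_seq x N k = P (n + 1)" "euclid_seq x N (Suc k) = P n"
      using ge2.IH n by auto
    have un: "u n > 0" using pos n by blast
    have "n - 1 \<le> N" using n(2) by simp
    note m = monic[OF n(2)] monic[OF this]
    have dg: "degree (smult (- u n) (P (n - 1))) < degree (P n)"
      unfolding degree_smult_eq m(1)[THEN conjunct1] m(2)[THEN conjunct1] using n(1) un by simp
    have lc: "lead_coeff (P (n - 1)) = 1"
      by (rule m(2)[THEN conjunct2])
    have "P (n + 1) = smult (- u n) (P (n - 1)) + [:- b n, 1:] * P n"
      using rec[OF n(1,2)] by simp
    then have "P (n + 1) mod P n = smult (- u n) (P (n - 1)) mod P n"
      by (simp only: mod_mult_self1)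
    also have "\<dots> = smult (- u n) (P (n - 1))"
      by (rule mod_poly_less[OF dg])
    finally have "P (n + 1) mod P n = smult (- u n) (P (n - 1))" .
    then have "make_monic (P (n + 1) mod P n) = P (n - 1)"
      using un by (simp only: make_monic_def lead_coeff_smult lc) simp
    then show ?case using e n by simp
  qed (use top sub in auto)
  show ?thesis using step[of "N + 1 - n"] \<open>n \<le> N + 1\<close> by (simp add: sturmian_def)
qed

text \<open>The \<open>q\<close>-shifted factorial \<open>(y;q)\<^sub>k\<close>. It is polymorphic so that it can also be taken at the
  indeterminate \<open>y = [:0, 1:]\<close>, with base \<open>[:q:]\<close>.\<close>

definition qpoch :: "'a::comm_ring_1 \<Rightarrow> 'a \<Rightarrow> nat \<Rightarrow> 'a" where
  "qpoch y q k = (\<Prod>i<k. 1 - y * q ^ i)"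

definition qhahn_series :: "real \<Rightarrow> real \<Rightarrow> real \<Rightarrow> nat \<Rightarrow> nat \<Rightarrow> real poly" where
  "qhahn_series q \<alpha> \<beta> N n =
    (\<Sum>k\<le>n. smult (qpoch (q powi (- int n)) q k * qpoch (\<alpha> * \<beta> * q ^ (n + 1)) q k /
        (qpoch (q powi (- int N)) q k * qpoch (\<alpha> * q) q k * qpoch q q k) * q ^ k)
      (qpoch [:0, 1:] [:q:] k))"

text \<open>The hypergeometric formula is used only for \<open>n \<le> N\<close>, since \<open>(q\<^sup>-\<^sup>N;q)\<^sub>k\<close> vanishes for \<open>k > N\<close>;
  only the value \<open>n = N + 1\<close> of the other branch is meaningful.\<close>

definition monic_qhahn :: "real \<Rightarrow> real \<Rightarrow> real \<Rightarrow> nat \<Rightarrow> nat \<Rightarrow> real poly" where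
  "monic_qhahn q \<alpha> \<beta> N n =
    (if n \<le> N then make_monic (qhahn_series q \<alpha> \<beta> N n)
     else grid_poly (\<lambda>s. q powi (- int s)) N)"

definition christoffel_transform :: "(nat \<Rightarrow> real poly) \<Rightarrow> real \<Rightarrow> nat \<Rightarrow> real poly" where
  "christoffel_transform Q a n =
    (Q (n + 1) - smult (poly (Q (n + 1)) a / poly (Q n) a) (Q n)) div [:- a, 1:]"

lemma christoffel_transform_exact:
  assumes "poly (Q n) a \<noteq> 0"
  shows "[:- a, 1:] * christoffel_transform Q a n =
    Q (n + 1) - smult (poly (Q (n + 1)) a / poly (Q n) a) (Q n)"
proof -
  have "[:- a, 1:] dvd Q (n + 1) - smult (poly (Q (n + 1)) a / poly (Q n) a) (Q n)"
    using assms by (simp add: poly_eq_0_iff_dvd[symmetric])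
  then show ?thesis unfolding christoffel_transform_def by (rule dvd_mult_div_cancel)
qed

end

theory Submission
  imports Defs
begin

text \<open>
  Both sides of the identity are monic polynomials of degree \<open>n\<close>, orthogonal to all polynomials of
  smaller degree for one and the same positive weight on the grid, and such a polynomial is unique.

  Write \<open>G\<close> for the grid polynomial. The Sturmian polynomials are orthogonal for the weight
  \<open>1 / G'(x\<^sub>s)\<^sup>2\<close>: pairing \<open>G' / (N + 1)\<close> with \<open>p\<close> gives, up to a constant factor, the sum
  of \<open>p(x\<^sub>s) / G'(x\<^sub>s)\<close>, which is the coefficient of degree \<open>N\<close> of the interpolation polynomial of
  \<open>p\<close> and vanishes for \<open>degree p < N\<close>; and the Euclidean algorithm, started at two consecutive
  monic orthogonal polynomials, runs down the orthogonal family (\<open>sturmian_eq_monic_orth\<close>).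

  The \<open>q\<close>-Hahn polynomials with \<open>\<alpha> = \<beta> = q\<^sup>-\<^sup>N\<^sup>-\<^sup>1\<close> are orthogonal for the weight
  \<open>w\<^sub>s = [N choose s]\<^sub>q\<^sup>2 q\<^bsup>s*s\<^esup>\<close> (\<open>monic_orth_monic_qhahn\<close>). Here the test polynomials are
  chosen to be absorbed by one of the two Gaussian binomials of the weight, while the other one
  absorbs the factor \<open>(x;q)\<^sub>k\<close> of the hypergeometric sum. The sum over the grid is then a
  \<open>q\<close>-Vandermonde convolution, and the remaining sum over \<open>k\<close> is an alternating \<open>q\<close>-binomial sum of
  a polynomial in \<open>q\<^sup>-\<^sup>k\<close> of degree below \<open>n\<close>, which is zero.

  A Christoffel transform at \<open>0\<close> multiplies the weight by \<open>x\<close>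
  (\<open>monic_orth_christoffel_transform\<close>), and a direct evaluation of \<open>G'(x\<^sub>s)\<close> shows that
  \<open>w\<^sub>s x\<^sub>s G'(x\<^sub>s)\<^sup>2\<close> does not depend on \<open>s\<close> (\<open>christoffel_weight\<close>).
\<close>

section \<open>Orthogonality on a finite grid and Sturmian sequences\<close>

text \<open>The condition involves only the values of \<open>p\<close> on the grid and puts no bound on its degree, so
  the grid polynomial itself satisfies it for every \<open>n\<close>. This lets it serve as the member of
  degree \<open>N + 1\<close> of an orthogonal family.\<close>

definition orth_below :: "(nat \<Rightarrow> real) \<Rightarrow> (nat \<Rightarrow> real) \<Rightarrow> nat \<Rightarrow> nat \<Rightarrow> real poly \<Rightarrow> bool" where
  "orth_below w x N n p \<longleftrightarrow>
    (\<forall>r. degree r < n \<longrightarrow> (\<Sum>s\<le>N. w s * poly (p * r) (x s)) = 0)"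

definition monic_orth :: "(nat \<Rightarrow> real) \<Rightarrow> (nat \<Rightarrow> real) \<Rightarrow> nat \<Rightarrow> nat \<Rightarrow> real poly \<Rightarrow> bool" where
  "monic_orth w x N n p \<longleftrightarrow> degree p = n \<and> lead_coeff p = 1 \<and> orth_below w x N n p"

lemma orth_belowD:
  "orth_below w x N n p \<Longrightarrow> degree r < n \<Longrightarrow> (\<Sum>s\<le>N. w s * poly (p * r) (x s)) = 0"
  by (simp add: orth_below_def)

lemma degree_grid_poly: "degree (grid_poly x N) = Suc N"
  by (simp add: grid_poly_def degree_prod_eq_sum_degree)

lemma monic_grid_poly: "lead_coeff (grid_poly x N) = 1"
  by (simp add: grid_poly_def lead_coeff_prod)

lemma poly_grid_poly: "s \<le> N \<Longrightarrow> poly (grid_poly x N) (x s) = 0"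
  unfolding grid_poly_def poly_prod by (rule prod_zero) auto

lemma poly_pderiv_grid_poly:
  assumes "s \<le> N"
  shows "poly (pderiv (grid_poly x N)) (x s) = (\<Prod>j\<in>{..N} - {s}. x s - x j)"
proof -
  have fct: "grid_poly x N = [:- x s, 1:] * (\<Prod>j\<in>{..N} - {s}. [:- x j, 1:])"
    unfolding grid_poly_def using assms by (simp add: prod.remove)
  show ?thesis
    unfolding fct pderiv_mult by (simp add: poly_prod pderiv_pCons)
qed

lemma poly_pderiv_grid_poly_nonzero:
  assumes "inj_on x {..N}" "s \<le> N"
  shows "poly (pderiv (grid_poly x N)) (x s) \<noteq> 0"
  using assms by (auto simp: poly_pderiv_grid_poly inj_on_def)

lemma poly_eq_0_on_grid:
  fixes p :: "real poly"
  assumes inj: "inj_on x {..N}" and deg: "degree p \<le> N" and zero: "\<And>s. s \<le> N \<Longrightarrow> poly p (x s) = 0"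
  shows "p = 0"
proof (rule ccontr)
  assume "p \<noteq> 0"
  have "card (x ` {..N}) \<le> card {y. poly p y = 0}"
    using zero by (intro card_mono poly_roots_finite[OF \<open>p \<noteq> 0\<close>]) auto
  also have "\<dots> \<le> degree p"
    by (rule card_poly_roots_bound[OF \<open>p \<noteq> 0\<close>])
  finally show False
    using deg card_image[OF inj] by simp
qed

text \<open>The form attached to the weight is definite only up to degree \<open>N\<close>, where a nonzero polynomial
  cannot vanish at all \<open>N + 1\<close> grid points.\<close>

lemma grid_square_sum_pos:
  assumes inj: "inj_on x {..N}" and pos: "\<And>s. s \<le> N \<Longrightarrow> w s > 0"
    and deg: "degree p \<le> N" and "p \<noteq> 0"
  shows "(\<Sum>s\<le>N. w s * poly (p * p) (x s)) > (0::real)"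
proof -
  obtain s where s: "s \<le> N" "poly p (x s) \<noteq> 0"
    using poly_eq_0_on_grid[OF inj deg] \<open>p \<noteq> 0\<close> by blast
  show ?thesis
  proof (rule sum_pos2)
    show "0 < w s * poly (p * p) (x s)"
      using pos[OF s(1)] s(2) by (simp add: zero_less_mult_iff) linarith
    show "0 \<le> w i * poly (p * p) (x i)" if "i \<in> {..N}" for i
      using pos[of i] that by simp
  qed (use s in auto)
qed

text \<open>Uniqueness of orthogonal polynomials: the difference of the two sides has degree below \<open>n\<close> and
  is orthogonal to all such polynomials, hence to itself.\<close>

lemma orth_below_proportional:
  assumes inj: "inj_on x {..N}" and pos: "\<And>s. s \<le> N \<Longrightarrow> w s > 0" and "n \<le> N"
    and p: "monic_orth w x N n p" and f: "degree f \<le> n" "orth_below w x N n f"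
  shows "f = smult (coeff f n) p"
proof -
  define d where "d = f - smult (coeff f n) p"
  have p': "degree p = n" "coeff p n = 1" "orth_below w x N n p"
    using p by (auto simp: monic_orth_def)
  have "degree d \<le> n" "coeff d n = 0"
    using f p' by (auto simp: d_def degree_diff_le)
  have "d = 0"
  proof (rule ccontr)
    assume "d \<noteq> 0"
    then have dn: "degree d < n"
      using \<open>degree d \<le> n\<close> \<open>coeff d n = 0\<close> by (metis le_neq_implies_less leading_coeff_0_iff)
    have "(\<Sum>s\<le>N. w s * poly (d * d) (x s)) =
        (\<Sum>s\<le>N. w s * poly (f * d) (x s)) - coeff f n * (\<Sum>s\<le>N. w s * poly (p * d) (x s))"
      by (simp add: d_def algebra_simps sum_subtractf sum.distrib sum_distrib_left)
    also have "\<dots> = 0"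
      using orth_belowD[OF f(2) dn] orth_belowD[OF p'(3) dn] by simp
    finally show False
      using grid_square_sum_pos[where w = w, OF inj pos _ \<open>d \<noteq> 0\<close>] dn \<open>n \<le> N\<close> by simp
  qed
  then show ?thesis by (simp add: d_def)
qed

text \<open>By Lagrange interpolation the sum is the coefficient of degree \<open>N\<close> of the interpolation
  polynomial of \<open>p\<close>, which is \<open>p\<close> itself.\<close>

lemma sum_over_pderiv_grid_poly:
  fixes p :: "real poly"
  assumes inj: "inj_on x {..N}" and deg: "degree p < N"
  shows "(\<Sum>s\<le>N. poly p (x s) / poly (pderiv (grid_poly x N)) (x s)) = 0"
proof -
  define D where "D s = poly (pderiv (grid_poly x N)) (x s)" for s
  define l where "l s = (\<Prod>j\<in>{..N} - {s}. [:- x j, 1:])" for s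
  define f where "f = (\<Sum>s\<le>N. smult (poly p (x s) / D s) (l s))"
  have D: "D s = poly (l s) (x s)" "D s \<noteq> 0" if "s \<le> N" for s
    using that poly_pderiv_grid_poly[OF that, of x] poly_pderiv_grid_poly_nonzero[OF inj that]
    by (auto simp: D_def l_def poly_prod)
  have l_other: "poly (l s) (x t) = 0" if "t \<le> N" "s \<noteq> t" for s t
    unfolding l_def poly_prod using that by (intro prod_zero) auto
  have l_deg: "degree (l s) = N" if "s \<le> N" for s
    using that by (simp add: l_def degree_prod_eq_sum_degree)
  have l_lc: "coeff (l s) N = 1" if "s \<le> N" for s
    using lead_coeff_prod[of "\<lambda>j. [:- x j, 1:]" "{..N} - {s}"] l_deg[OF that] by (simp add: l_def)
  have "poly f (x t) = poly p (x t)" if "t \<le> N" for t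
  proof -
    have "poly f (x t) = (\<Sum>s\<le>N. if s = t then poly p (x t) else 0)"
      unfolding f_def poly_sum
      by (rule sum.cong) (use that D[of t] l_other in auto)
    then show ?thesis using that by simp
  qed
  moreover have "degree f \<le> N"
    unfolding f_def by (rule degree_sum_le) (use l_deg degree_smult_le in fastforce)+
  ultimately have "f - p = 0"
    by (intro poly_eq_0_on_grid[OF inj]) (use deg in \<open>auto intro: degree_diff_le\<close>)
  then have "coeff f N = 0"
    using deg by (simp add: coeff_eq_0)
  then show ?thesis
    by (simp add: f_def coeff_sum l_lc D_def)
qed

text \<open>This is why the weight must be proportional to \<open>1 / G'\<^sup>2\<close>: one factor \<open>G'\<close> cancels and the
  vanishing sum above remains.\<close>

lemma monic_orth_pderiv_grid_poly:
  assumes inj: "inj_on x {..N}"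
    and weight: "\<And>s. s \<le> N \<Longrightarrow> w s * (poly (pderiv (grid_poly x N)) (x s))\<^sup>2 = C"
  shows "monic_orth w x N N (smult (1 / real (N + 1)) (pderiv (grid_poly x N)))"
proof -
  define G where "G = grid_poly x N"
  have deg: "degree (pderiv G) = N"
    by (simp add: degree_pderiv degree_grid_poly G_def)
  have lc: "coeff (pderiv G) N = real (N + 1)"
    using monic_grid_poly[of x N] by (simp add: coeff_pderiv degree_grid_poly G_def)
  have "(\<Sum>s\<le>N. w s * poly (smult (1 / real (N + 1)) (pderiv G) * r) (x s)) = 0"
    if "degree r < N" for r
  proof -
    have "w s * poly (smult (1 / real (N + 1)) (pderiv G) * r) (x s) =
        C / real (N + 1) * (poly r (x s) / poly (pderiv G) (x s))" if "s \<le> N" for s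
    proof -
      have "w s * poly (pderiv G) (x s) = C / poly (pderiv G) (x s)"
        using weight[OF that] poly_pderiv_grid_poly_nonzero[OF inj that]
        by (simp add: G_def eq_divide_eq power2_eq_square mult.assoc)
      then have "w s * poly (pderiv G) (x s) * (poly r (x s) / real (N + 1)) =
          C / poly (pderiv G) (x s) * (poly r (x s) / real (N + 1))"
        by (rule arg_cong)
      then show ?thesis by (simp add: mult_ac)
    qed
    then have "(\<Sum>s\<le>N. w s * poly (smult (1 / real (N + 1)) (pderiv G) * r) (x s)) =
        C / real (N + 1) * (\<Sum>s\<le>N. poly r (x s) / poly (pderiv G) (x s))"
      unfolding sum_distrib_left by (intro sum.cong) auto
    then show ?thesis
      using sum_over_pderiv_grid_poly[OF inj \<open>degree r < N\<close>] by (simp add: G_def)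
  qed
  then show ?thesis
    using deg lc by (auto simp: monic_orth_def orth_below_def G_def[symmetric])
qed

text \<open>The remainder \<open>A - D B\<close> has degree below \<open>n\<close>. It is orthogonal to every \<open>r\<close> of degree below
  \<open>n - 1\<close>, since \<open>A\<close> is orthogonal to \<open>r\<close> and \<open>B\<close> to \<open>D r\<close>; by uniqueness it is a multiple
  of \<open>C\<close>.\<close>

lemma make_monic_mod_monic_orth:
  assumes inj: "inj_on x {..N}" and pos: "\<And>s. s \<le> N \<Longrightarrow> w s > 0" and n: "1 \<le> n" "n \<le> N"
    and A: "monic_orth w x N (n + 1) A" and B: "monic_orth w x N n B"
    and C: "monic_orth w x N (n - 1) C"
  shows "make_monic (A mod B) = C"
proof -
  define T where "T = A mod B"
  define D where "D = A div B"
  have degs: "degree A = n + 1" "degree B = n" "degree C = n - 1"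
    and lcs: "lead_coeff A = 1" "lead_coeff B = 1" "lead_coeff C = 1"
    and orth: "orth_below w x N (n + 1) A" "orth_below w x N n B"
    using A B C by (auto simp: monic_orth_def)
  have B0: "B \<noteq> 0" and C0: "C \<noteq> 0" using lcs by auto
  have split: "T = A - D * B"
    by (simp add: T_def D_def minus_div_mult_eq_mod)
  have "degree T < n"
    using degree_mod_less[OF B0, of A] degs n unfolding T_def by auto
  then have "degree (A + (- T)) = n + 1"
    using degs by (subst degree_add_eq_left) auto
  then have degDB: "degree (D * B) = n + 1"
    by (simp add: split)
  then have "D \<noteq> 0" by auto
  then have degD: "degree D = 1"
    using degDB degs B0 by (simp add: degree_mult_eq)
  have sum_T: "(\<Sum>s\<le>N. w s * poly (T * r) (x s)) =
      - (\<Sum>s\<le>N. w s * poly (B * (D * r)) (x s))" if "degree r < n + 1" for r :: "real poly"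
    using orth_belowD[OF orth(1) that]
    by (simp add: split algebra_simps sum_subtractf)
  have degT: "degree T \<le> n - 1"
    using \<open>degree T < n\<close> by simp
  have "orth_below w x N (n - 1) T"
    unfolding orth_below_def
  proof (intro allI impI)
    fix r :: "real poly" assume r: "degree r < n - 1"
    have "degree (D * r) < n"
      using degree_mult_le[of D r] r degD by linarith
    then show "(\<Sum>s\<le>N. w s * poly (T * r) (x s)) = 0"
      using sum_T[of r] r orth_belowD[OF orth(2), of "D * r"] by simp
  qed
  then have T_eq: "T = smult (coeff T (n - 1)) C"
    using n by (intro orth_below_proportional[where w = w, OF inj pos _ C degT]) auto
  \<comment> \<open>If the remainder vanished, \<open>A = D B\<close> and \<open>A\<close> is orthogonal to \<open>C\<close>; but \<open>D C\<close> has degree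
    \<open>n\<close>, so pairing it with \<open>B\<close> gives a nonzero multiple of the square sum of \<open>B\<close>.\<close>
  have "T \<noteq> 0"
  proof
    assume "T = 0"
    have DC: "degree (D * C) = n" "D * C \<noteq> 0"
      using degD degs C0 n \<open>D \<noteq> 0\<close> by (auto simp: degree_mult_eq)
    define e where "e = coeff (D * C) n"
    have "e \<noteq> 0" using DC leading_coeff_0_iff unfolding e_def by metis
    have coeffB: "coeff B n = 1" using degs lcs by metis
    have "degree (D * C - smult e B) < n"
    proof (rule le_neq_implies_less)
      show "degree (D * C - smult e B) \<le> n"
        using DC degs by (intro degree_diff_le) auto
      have "coeff (D * C - smult e B) n = 0"
        by (simp add: e_def coeffB)
      then show "degree (D * C - smult e B) \<noteq> n"
        using n by (metis degree_0 leading_coeff_0_iff not_one_le_zero)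
    qed
    then have "(\<Sum>s\<le>N. w s * poly (B * (D * C - smult e B)) (x s)) = 0"
      by (rule orth_belowD[OF orth(2)])
    then have "(\<Sum>s\<le>N. w s * poly (B * (D * C)) (x s)) = e * (\<Sum>s\<le>N. w s * poly (B * B) (x s))"
      by (simp add: algebra_simps sum_subtractf sum_distrib_left)
    moreover have "(\<Sum>s\<le>N. w s * poly (B * (D * C)) (x s)) = 0"
      using sum_T[of C] \<open>T = 0\<close> degs by simp
    ultimately show False
      using grid_square_sum_pos[where w = w, OF inj pos _ B0] degs n \<open>e \<noteq> 0\<close> by simp
  qed
  then have "coeff T (n - 1) \<noteq> 0" using T_eq by auto
  then have "make_monic (smult (coeff T (n - 1)) C) = C"
    using lcs by (simp add: make_monic_def)
  then show ?thesis using T_eq by (simp add: T_def)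
qed

text \<open>The grid polynomial and its normalized derivative are the top two members of the orthogonal
  family; every later step of the Euclidean algorithm descends by one degree.\<close>

theorem sturmian_eq_monic_orth:
  assumes inj: "inj_on x {..N}" and pos: "\<And>s. s \<le> N \<Longrightarrow> w s > 0"
    and weight: "\<And>s. s \<le> N \<Longrightarrow> w s * (poly (pderiv (grid_poly x N)) (x s))\<^sup>2 = C"
    and orth: "\<And>n. n \<le> N \<Longrightarrow> monic_orth w x N n (R n)" and "n \<le> N"
  shows "sturmian x N n = R n"
proof -
  define S where "S n = (if n \<le> N then R n else grid_poly x N)" for n
  have S: "monic_orth w x N n (S n)" if "n \<le> N + 1" for n
  proof (cases "n \<le> N")
    case False
    with that have "n = Suc N" by simp
    then show ?thesis
      using degree_grid_poly[of x N] monic_grid_poly[of x N]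
      by (simp add: S_def monic_orth_def orth_below_def poly_grid_poly)
  qed (simp add: S_def orth)
  have "euclid_seq x N k = S (N + 1 - k)" if "k \<le> N + 1" for k
    using that
  proof (induction k rule: induct_nat_012)
    case 1
    let ?d = "smult (1 / real (N + 1)) (pderiv (grid_poly x N))"
    have d: "monic_orth w x N N ?d"
      using monic_orth_pderiv_grid_poly[OF inj weight] by blast
    have "?d = smult (coeff ?d N) (S N)"
      by (rule orth_below_proportional[where w = w, OF inj pos order_refl S])
        (use d in \<open>auto simp: monic_orth_def\<close>)
    moreover have "coeff ?d N = 1"
      using d unfolding monic_orth_def by metis
    ultimately have "?d = S N"
      by (metis smult_1_left)
    then show ?case by simp
  next
    case (ge2 k)
    then have "make_monic (S (N - k + 1) mod S (N - k)) = S (N - k - 1)"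
      by (intro make_monic_mod_monic_orth[where w = w and n = "N - k", OF inj pos] S) auto
    then show ?case
      using ge2 by (simp add: Suc_diff_le)
  qed (simp add: S_def)
  from this[of "N + 1 - n"] show ?thesis
    using \<open>n \<le> N\<close> by (simp add: sturmian_def S_def)
qed

text \<open>If \<open>p = x h\<close>, pairing \<open>p\<close> with \<open>h\<close> gives the positive weighted sum of \<open>x\<^sub>s h(x\<^sub>s)\<^sup>2\<close>, although
  \<open>h\<close> has smaller degree than \<open>p\<close>.\<close>

lemma monic_orth_nonzero_at_0:
  assumes inj: "inj_on x {..N}" and pos: "\<And>s. s \<le> N \<Longrightarrow> w s > 0"
    and grid: "\<And>s. s \<le> N \<Longrightarrow> x s > 0" and p: "monic_orth w x N n p" and "n \<le> N + 1"
  shows "poly p 0 \<noteq> 0"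
proof
  assume "poly p 0 = 0"
  then obtain h where h: "p = [:0, 1:] * h"
    using poly_eq_0_iff_dvd[of p 0] by auto
  have p': "degree p = n" "p \<noteq> 0" "orth_below w x N n p"
    using p by (auto simp: monic_orth_def)
  have h0: "h \<noteq> 0" and n: "n = Suc (degree h)" using h p' by (auto simp: degree_mult_eq)
  have "(\<Sum>s\<le>N. (w s * x s) * poly (h * h) (x s)) = (\<Sum>s\<le>N. w s * poly (p * h) (x s))"
    by (simp add: h algebra_simps)
  also have "\<dots> = 0"
    by (rule orth_belowD[OF p'(3)]) (simp add: n)
  finally show False
    using grid_square_sum_pos[where w = "\<lambda>s. w s * x s", OF inj _ _ h0] pos grid n \<open>n \<le> N + 1\<close>
    by simp
qed

text \<open>The factor \<open>x\<close> of the new weight cancels the denominator of the transform, leaving a combination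
  of two polynomials of the old family.\<close>

lemma monic_orth_christoffel_transform:
  assumes inj: "inj_on x {..N}" and pos: "\<And>s. s \<le> N \<Longrightarrow> w s > 0"
    and grid: "\<And>s. s \<le> N \<Longrightarrow> x s > 0"
    and Q: "monic_orth w x N n (Q n)" "monic_orth w x N (n + 1) (Q (n + 1))" and "n \<le> N"
  shows "monic_orth (\<lambda>s. w s * x s) x N n (christoffel_transform Q 0 n)"
proof -
  define K where "K = christoffel_transform Q 0 n"
  define c where "c = poly (Q (n + 1)) 0 / poly (Q n) 0"
  have "poly (Q n) 0 \<noteq> 0"
    by (rule monic_orth_nonzero_at_0[where w = w, OF inj pos grid Q(1)]) (use \<open>n \<le> N\<close> in auto)
  from christoffel_transform_exact[where Q = Q, OF this]
  have K: "[:0, 1:] * K = Q (n + 1) - smult c (Q n)"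
    by (simp add: K_def c_def)
  have Q': "degree (Q n) = n" "degree (Q (n + 1)) = n + 1" "coeff (Q (n + 1)) (n + 1) = 1"
    using Q unfolding monic_orth_def by metis+
  have *: "degree ([:0, 1:] * K) = n + 1" "coeff ([:0, 1:] * K) (n + 1) = 1"
  proof -
    show "coeff ([:0, 1:] * K) (n + 1) = 1"
      unfolding K using Q' by (simp add: coeff_eq_0)
    moreover have "degree ([:0, 1:] * K) \<le> n + 1"
      unfolding K using Q' by (intro degree_diff_le) (auto intro: order.trans[OF degree_smult_le])
    ultimately show "degree ([:0, 1:] * K) = n + 1"
      by (metis le_antisym le_degree one_neq_zero)
  qed
  then have "K \<noteq> 0" by auto
  then have "degree K = n" "coeff K n = 1"
    using * by (simp_all add: degree_mult_eq)
  moreover have "(\<Sum>s\<le>N. (w s * x s) * poly (K * r) (x s)) = 0" if "degree r < n" for r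
  proof -
    have "(\<Sum>s\<le>N. (w s * x s) * poly (K * r) (x s)) =
        (\<Sum>s\<le>N. w s * poly ([:0, 1:] * K * r) (x s))"
      by (simp add: algebra_simps)
    also have "\<dots> = (\<Sum>s\<le>N. w s * poly (Q (n + 1) * r) (x s)) -
        c * (\<Sum>s\<le>N. w s * poly (Q n * r) (x s))"
      unfolding K by (simp add: algebra_simps sum_subtractf sum_distrib_left)
    also have "\<dots> = 0"
      using Q orth_belowD that by (force simp: monic_orth_def)
    finally show ?thesis .
  qed
  ultimately show ?thesis
    by (simp add: monic_orth_def orth_below_def K_def)
qed

section \<open>Gaussian binomial coefficients\<close>

text \<open>The Gaussian binomial coefficient, by the \<open>q\<close>-Pascal rule without subtraction in the exponents.\<close>

fun qbinom :: "real \<Rightarrow> nat \<Rightarrow> nat \<Rightarrow> real" where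
  "qbinom q n 0 = 1"
| "qbinom q 0 (Suc k) = 0"
| "qbinom q (Suc n) (Suc k) = q ^ Suc k * qbinom q n (Suc k) + qbinom q n k"

lemma qbinom_eq_0: "n < k \<Longrightarrow> qbinom q n k = 0"
  by (induction q n k rule: qbinom.induct) auto

lemma qpoch_0 [simp]: "qpoch y q 0 = 1"
  by (simp add: qpoch_def)

lemma qpoch_Suc: "qpoch y q (Suc k) = qpoch y q k * (1 - y * q ^ k)"
  by (simp add: qpoch_def)

lemma qpoch_Suc_left: "qpoch y q (Suc k) = (1 - y) * qpoch (q * y) q k"
  unfolding qpoch_def by (subst prod.lessThan_Suc_shift) (simp add: mult_ac)

lemma qpoch_self_Suc: "qpoch q q (Suc k) = qpoch q q k * (1 - q ^ Suc k)"
  by (simp add: qpoch_Suc)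

lemma qpoch_self_nonzero:
  assumes "0 < q" "q < (1::real)"
  shows "qpoch q q k \<noteq> 0"
proof -
  have "q ^ Suc i \<noteq> 1" for i
    using assms power_Suc_less_one[of q i] by simp
  then show ?thesis by (induction k) (auto simp: qpoch_self_Suc)
qed

lemma qbinom_times_qpoch:
  "k \<le> n \<Longrightarrow> qbinom q n k * (qpoch q q k * qpoch q q (n - k)) = qpoch q q n"
proof (induction n arbitrary: k)
  case (Suc n)
  show ?case
  proof (cases k)
    case [simp]: (Suc j)
    have 1: "qbinom q n j * (qpoch q q j * qpoch q q (n - j)) = qpoch q q n"
      using Suc.IH[of j] Suc.prems by simp
    have 2: "qbinom q n (Suc j) * (qpoch q q (Suc j) * qpoch q q (n - j)) =
        qpoch q q n * (1 - q ^ (n - j))"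
    proof (cases "j = n")
      case False
      then have j: "Suc j \<le> n" using Suc.prems by simp
      then have "n - j = Suc (n - Suc j)" by simp
      then have "qpoch q q (n - j) = qpoch q q (n - Suc j) * (1 - q ^ (n - j))"
        using qpoch_self_Suc[of q "n - Suc j"] by simp
      then show ?thesis
        using Suc.IH[OF j] by (simp add: mult_ac)
    qed (simp add: qbinom_eq_0)
    have "qbinom q (Suc n) k * (qpoch q q k * qpoch q q (Suc n - k)) =
        q ^ Suc j * (qbinom q n (Suc j) * (qpoch q q (Suc j) * qpoch q q (n - j))) +
        (1 - q ^ Suc j) * (qbinom q n j * (qpoch q q j * qpoch q q (n - j)))"
      by (simp add: qpoch_self_Suc algebra_simps)
    also have "\<dots> = qpoch q q n * (1 - q ^ (Suc j + (n - j)))"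
      unfolding 1 2 by (simp add: algebra_simps power_add)
    also have "\<dots> = qpoch q q (Suc n)"
      using Suc.prems by (simp add: qpoch_self_Suc)
    finally show ?thesis .
  qed simp
qed simp

lemma qbinom_eq:
  assumes "0 < q" "q < 1" "k \<le> n"
  shows "qbinom q n k = qpoch q q n / (qpoch q q k * qpoch q q (n - k))"
  using qbinom_times_qpoch[OF assms(3), of q] qpoch_self_nonzero[OF assms(1,2)]
  by (simp add: field_simps)

lemma qbinom_pos:
  assumes "0 < q" "k \<le> n"
  shows "qbinom q n k > 0"
  using assms(2)
proof (induction n arbitrary: k)
  case (Suc n)
  show ?case
  proof (cases k)
    case [simp]: (Suc j)
    have "qbinom q n (Suc j) \<ge> 0"
      using Suc.IH[of "Suc j"] by (cases "Suc j \<le> n") (auto simp: qbinom_eq_0 less_imp_le)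
    then show ?thesis
      using Suc.IH[of j] Suc.prems \<open>0 < q\<close> by (simp add: add_nonneg_pos)
  qed simp
qed simp

text \<open>For \<open>i > M\<close> the truncated exponent is harmless because \<open>qbinom q M i\<close> vanishes.\<close>

lemma q_vandermonde:
  "qbinom q (M + L) r = (\<Sum>i\<le>r. qbinom q M i * qbinom q L (r - i) * q ^ ((r - i) * (M - i)))"
proof (induction M arbitrary: r)
  case 0
  have "(\<Sum>i\<le>r. qbinom q 0 i * qbinom q L (r - i) * q ^ ((r - i) * (0 - i))) =
      (\<Sum>i\<le>r. if i = 0 then qbinom q L r else 0)"
    by (rule sum.cong) (auto simp: qbinom_eq_0)
  then show ?case by simp
next
  case (Suc M)
  show ?case
  proof (cases r)
    case [simp]: (Suc t)
    let ?f = "\<lambda>r i. qbinom q M i * qbinom q L (r - i) * q ^ ((r - i) * (M - i))"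
    let ?g = "\<lambda>i. qbinom q (Suc M) i * qbinom q L (r - i) * q ^ ((r - i) * (Suc M - i))"
    have shift: "q ^ i * (qbinom q M i * qbinom q L (r - i) * q ^ ((r - i) * (Suc M - i))) =
        q ^ r * ?f r i" if "i \<le> r" for i
    proof (cases "i \<le> M")
      case True
      then have "i + (r - i) * (Suc M - i) = r + (r - i) * (M - i)"
        using that by (simp add: Suc_diff_le)
      then have "q ^ i * q ^ ((r - i) * (Suc M - i)) = q ^ r * q ^ ((r - i) * (M - i))"
        by (simp only: power_add[symmetric])
      then show ?thesis by (simp add: mult_ac)
    qed (simp add: qbinom_eq_0)
    have "(\<Sum>i\<le>r. ?g i) = ?g 0 + (\<Sum>i\<le>t. ?g (Suc i))"
      unfolding \<open>r = Suc t\<close> by (rule sum.atMost_Suc_shift)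
    also have "(\<Sum>i\<le>t. ?g (Suc i)) = (\<Sum>i\<le>t. q ^ r * ?f r (Suc i) + ?f t i)"
    proof (rule sum.cong)
      fix i assume "i \<in> {..t}"
      then show "?g (Suc i) = q ^ r * ?f r (Suc i) + ?f t i"
        using shift[of "Suc i"] by (simp add: distrib_right mult.assoc)
    qed simp
    also have "?g 0 = q ^ r * ?f r 0"
      using shift[of 0] by simp
    also have "q ^ r * ?f r 0 + (\<Sum>i\<le>t. q ^ r * ?f r (Suc i) + ?f t i) =
        q ^ r * (\<Sum>i\<le>r. ?f r i) + (\<Sum>i\<le>t. ?f t i)"
      unfolding \<open>r = Suc t\<close> sum.atMost_Suc_shift[of "?f (Suc t)"]
      by (simp add: sum.distrib sum_distrib_left distrib_left)
    also have "\<dots> = qbinom q (Suc M + L) r"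
      unfolding Suc.IH[symmetric] by simp
    finally show ?thesis by simp
  qed simp
qed

lemma choose2_Suc: "Suc k choose 2 = (k choose 2) + k"
  by (simp add: numeral_2_eq_2)

text \<open>The induction step separates the factor \<open>1 - z\<close> and applies the hypothesis at \<open>q z\<close>.\<close>

lemma q_binomial_theorem:
  "(\<Sum>k\<le>n. (- 1) ^ k * q ^ (k choose 2) * qbinom q n k * z ^ k) = qpoch z q n"
proof (induction n arbitrary: z)
  case (Suc n)
  let ?f = "\<lambda>z k. (- 1) ^ k * q ^ (k choose 2) * qbinom q n k * z ^ k"
  let ?g = "\<lambda>k. (- 1) ^ k * q ^ (k choose 2) * qbinom q (Suc n) k * z ^ k"
  have "(\<Sum>k\<le>Suc n. ?g k) = ?g 0 + (\<Sum>k\<le>n. ?g (Suc k))"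
    by (rule sum.atMost_Suc_shift)
  also have "(\<Sum>k\<le>n. ?g (Suc k)) = (\<Sum>k\<le>n. ?f (q * z) (Suc k) - z * ?f (q * z) k)"
    by (rule sum.cong) (auto simp: choose2_Suc power_add power_mult_distrib algebra_simps)
  also have "?g 0 + \<dots> = (\<Sum>k\<le>Suc n. ?f (q * z) k) - z * (\<Sum>k\<le>n. ?f (q * z) k)"
    unfolding sum.atMost_Suc_shift[of "?f (q * z)"]
    by (simp add: sum_subtractf sum_distrib_left numeral_2_eq_2)
  also have "\<dots> = (1 - z) * (\<Sum>k\<le>n. ?f (q * z) k)"
    by (simp add: qbinom_eq_0 algebra_simps)
  finally show ?case
    by (simp add: Suc.IH qpoch_Suc_left)
qed (simp add: numeral_2_eq_2)

text \<open>The \<open>q\<close>-analogue of the vanishing of an \<open>n\<close>-th difference on polynomials of degree below \<open>n\<close>: on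
  the monomial of degree \<open>j\<close> the \<open>q\<close>-binomial theorem gives \<open>(q\<^sup>-\<^sup>j;q)\<^sub>n\<close>, which contains the factor
  zero for \<open>j < n\<close>.\<close>

lemma qbinom_alternating_poly_sum:
  assumes "q \<noteq> 0" and deg: "degree g < n"
  shows "(\<Sum>k\<le>n. (- 1) ^ k * q ^ (k choose 2) * qbinom q n k * poly g ((1 / q) ^ k)) = 0"
proof -
  let ?c = "\<lambda>k. (- 1) ^ k * q ^ (k choose 2) * qbinom q n k"
  have zero: "(\<Sum>k\<le>n. ?c k * ((1 / q) ^ k) ^ j) = 0" if "j < n" for j
  proof -
    have "(\<Sum>k\<le>n. ?c k * ((1 / q) ^ k) ^ j) = qpoch ((1 / q) ^ j) q n"
      by (subst q_binomial_theorem[symmetric]) (simp add: power_mult[symmetric] mult.commute)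
    also have "\<dots> = 0"
      unfolding qpoch_def using that \<open>q \<noteq> 0\<close>
      by (intro prod_zero) (auto intro!: bexI[of _ j] simp: power_mult_distrib[symmetric])
    finally show ?thesis .
  qed
  have "(\<Sum>k\<le>n. ?c k * poly g ((1 / q) ^ k)) =
      (\<Sum>j\<le>degree g. coeff g j * (\<Sum>k\<le>n. ?c k * ((1 / q) ^ k) ^ j))"
    unfolding poly_altdef sum_distrib_left by (subst sum.swap) (simp add: mult_ac)
  also have "\<dots> = 0"
    using zero deg by simp
  finally show ?thesis .
qed

section \<open>Orthogonality of the \<open>q\<close>-Hahn polynomials\<close>

text \<open>The product of \<open>1 - q\<^bsup>M - i\<^esup> x\<close> over \<open>i < m\<close>. At \<open>x = q\<^sup>-\<^sup>s\<close> with \<open>s + m \<le> M\<close> this is the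
  \<open>q\<close>-falling factorial \<open>(q;q)\<^bsub>M-s\<^esub> / (q;q)\<^bsub>M-s-m\<^esub>\<close> of \<open>M - s\<close>. Multiplying by it therefore
  lowers the upper index of the Gaussian binomial \<open>[M choose s]\<close> by \<open>m\<close>, up to a factor that does
  not depend on \<open>s\<close>.\<close>

definition qfall :: "real \<Rightarrow> nat \<Rightarrow> nat \<Rightarrow> real poly" where
  "qfall q M m = (\<Prod>i<m. [:1, - (q ^ (M - i)):])"

lemma degree_qfall: "q \<noteq> 0 \<Longrightarrow> degree (qfall q M m) = m"
  by (simp add: qfall_def degree_prod_eq_sum_degree)

lemma poly_qfall:
  assumes "q \<noteq> 0"
  shows "k + m \<le> M \<Longrightarrow> poly (qfall q M m) ((1 / q) ^ k) * qpoch q q (M - k - m) = qpoch q q (M - k)"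
proof (induction m)
  case (Suc m)
  have "1 + (1 / q) ^ k * - (q ^ (M - m)) = 1 - q ^ Suc (M - k - Suc m)"
  proof -
    have "M - m = k + Suc (M - k - Suc m)" using Suc.prems by simp
    then have "q ^ (M - m) = q ^ k * q ^ Suc (M - k - Suc m)" by (metis power_add)
    then show ?thesis using assms by (simp add: power_one_over)
  qed
  moreover have "poly (qfall q M (Suc m)) ((1 / q) ^ k) =
      poly (qfall q M m) ((1 / q) ^ k) * (1 + (1 / q) ^ k * - (q ^ (M - m)))"
    by (simp add: qfall_def algebra_simps)
  ultimately have "poly (qfall q M (Suc m)) ((1 / q) ^ k) =
      poly (qfall q M m) ((1 / q) ^ k) * (1 - q ^ Suc (M - k - Suc m))"
    by simp
  moreover have "M - k - m = Suc (M - k - Suc m)" using Suc.prems by simp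
  then have "qpoch q q (M - k - m) = qpoch q q (M - k - Suc m) * (1 - q ^ Suc (M - k - Suc m))"
    by (metis qpoch_self_Suc)
  ultimately show ?case
    using Suc.IH Suc.prems by (simp add: mult_ac)
qed (simp add: qfall_def)

lemma poly_qfall_eq_0:
  assumes "q \<noteq> 0" "k \<le> M" "M < k + m"
  shows "poly (qfall q M m) ((1 / q) ^ k) = 0"
  unfolding qfall_def poly_prod using assms
  by (intro prod_zero) (auto intro!: bexI[of _ "M - k"] simp: power_one_over)

lemma qpoch_inverse_power:
  fixes q :: real
  assumes "q \<noteq> 0"
  shows "k \<le> a \<Longrightarrow> qpoch ((1 / q) ^ a) q k * (q ^ (a * k) * qpoch q q (a - k)) =
    (- 1) ^ k * q ^ (k choose 2) * qpoch q q a"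
proof (induction k)
  case (Suc k)
  have a: "a - k = Suc (a - Suc k)" using Suc.prems by simp
  have "a = k + Suc (a - Suc k)" using Suc.prems by simp
  then have "q ^ a = q ^ k * q ^ Suc (a - Suc k)" by (metis power_add)
  moreover have "(1 / q) ^ a * q ^ a = 1"
    using assms by (simp add: power_one_over)
  then have "(1 - (1 / q) ^ a * q ^ k) * q ^ a = q ^ a - q ^ k"
    by (simp add: algebra_simps)
  ultimately have "(1 - (1 / q) ^ a * q ^ k) * q ^ a = - (q ^ k * (1 - q ^ Suc (a - Suc k)))"
    by (simp add: algebra_simps)
  note step = this
  have "qpoch ((1 / q) ^ a) q (Suc k) * (q ^ (a * Suc k) * qpoch q q (a - Suc k)) =
      qpoch ((1 / q) ^ a) q k * (q ^ (a * k) * qpoch q q (a - Suc k)) *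
        ((1 - (1 / q) ^ a * q ^ k) * q ^ a)"
    by (simp add: qpoch_Suc power_add mult_ac)
  also have "\<dots> = - (q ^ k) * (qpoch ((1 / q) ^ a) q k * (q ^ (a * k) * qpoch q q (a - k)))"
    unfolding step a qpoch_self_Suc by (simp add: mult_ac)
  finally have "qpoch ((1 / q) ^ a) q (Suc k) * (q ^ (a * Suc k) * qpoch q q (a - Suc k)) =
      - (q ^ k) * (qpoch ((1 / q) ^ a) q k * (q ^ (a * k) * qpoch q q (a - k)))" .
  then show ?case
    using Suc by (simp add: choose2_Suc power_add mult_ac)
qed (simp add: numeral_2_eq_2)

lemma qpoch_inverse_power_eq:
  fixes q :: real
  assumes "0 < q" "q < 1" "k \<le> a"
  shows "qpoch ((1 / q) ^ a) q k =
    (- 1) ^ k * q ^ (k choose 2) * qpoch q q a / (q ^ (a * k) * qpoch q q (a - k))"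
  using qpoch_inverse_power[of q k a] qpoch_self_nonzero[OF assms(1,2)] assms
  by (simp add: field_simps)

lemma qpoch_inverse_power_eq_0:
  assumes "q \<noteq> 0" "a < k"
  shows "qpoch ((1 / q) ^ a) q k = (0::real)"
  unfolding qpoch_def using assms
  by (intro prod_zero) (auto intro!: bexI[of _ a] simp: power_mult_distrib[symmetric])

text \<open>The \<open>q\<close>-Hahn weight for \<open>\<alpha> = \<beta> = q\<^sup>-\<^sup>N\<^sup>-\<^sup>1\<close>; the Gaussian binomial occurs squared
  because the two numerator parameters of the general weight coincide, and so do the two
  denominator parameters.\<close>

definition qhahn_weight :: "real \<Rightarrow> nat \<Rightarrow> nat \<Rightarrow> real" where
  "qhahn_weight q N s = (qbinom q N s)\<^sup>2 * q ^ s\<^sup>2"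

text \<open>Each of the two binomials in the weight absorbs one factor: \<open>(q\<^sup>-\<^sup>s;q)\<^sub>k\<close> is, up to sign and a
  power of \<open>q\<close>, the \<open>q\<close>-falling factorial of \<open>s\<close> and cuts \<open>[N choose s]\<close> down to \<open>[N - k choose N - s]\<close>,
  while \<open>qfall\<close> cuts the other one down to \<open>[N - m choose s]\<close>. Where a factor vanishes, so does the
  reduced binomial.\<close>

lemma qhahn_weight_term:
  assumes q: "0 < q" "q < 1" and k: "k \<le> N" and m: "m \<le> N" and s: "s \<le> N"
  shows "qhahn_weight q N s * (qpoch ((1 / q) ^ s) q k * poly (qfall q N m) ((1 / q) ^ s)) =
    (- 1) ^ k * q ^ (k choose 2) * (qpoch q q N)\<^sup>2 / (qpoch q q (N - k) * qpoch q q (N - m)) *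
    (qbinom q (N - k) (N - s) * qbinom q (N - m) s * q ^ (s * (s - k)))"
proof (cases "k \<le> s \<and> s + m \<le> N")
  case True
  note nz = qpoch_self_nonzero[OF q]
  have 1: "poly (qfall q N m) ((1 / q) ^ s) = qpoch q q (N - s) / qpoch q q (N - m - s)"
    using poly_qfall[of q s m N] True q nz by (simp add: field_simps diff_commute)
  have "s\<^sup>2 = s * k + s * (s - k)"
    using True by (metis add_mult_distrib2 le_add_diff_inverse power2_eq_square)
  then have 2: "q ^ s\<^sup>2 = q ^ (s * k) * q ^ (s * (s - k))" by (simp add: power_add)
  have 3: "N - k - (N - s) = s - k" using s True by simp
  have b: "qbinom q N s = qpoch q q N / (qpoch q q s * qpoch q q (N - s))"
    "qbinom q (N - k) (N - s) = qpoch q q (N - k) / (qpoch q q (N - s) * qpoch q q (s - k))"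
    "qbinom q (N - m) s = qpoch q q (N - m) / (qpoch q q s * qpoch q q (N - m - s))"
    using qbinom_eq[OF q, of s N] qbinom_eq[OF q, of "N - s" "N - k"] qbinom_eq[OF q, of s "N - m"]
      True s k m 3 by auto
  have 4: "qpoch ((1 / q) ^ s) q k =
    (- 1) ^ k * q ^ (k choose 2) * qpoch q q s / (q ^ (s * k) * qpoch q q (s - k))"
    using qpoch_inverse_power_eq[OF q] True by blast
  show ?thesis
    unfolding qhahn_weight_def 1 2 b 4
    using nz q by (simp add: field_simps power2_eq_square)
next
  case False
  then consider "s < k" | "N < s + m" by linarith
  then show ?thesis
  proof cases
    case 1
    then have "N - k < N - s" using k s by simp
    then show ?thesis
      using 1 q by (simp add: qpoch_inverse_power_eq_0 qbinom_eq_0)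
  next
    case 2
    then have "N - m < s" using m s by simp
    then show ?thesis
      using 2 q s by (simp add: poly_qfall_eq_0 qbinom_eq_0)
  qed
qed

lemma qhahn_weight_moment:
  assumes q: "0 < q" "q < 1" and k: "k \<le> N" and m: "m \<le> N"
  shows "(\<Sum>s\<le>N. qhahn_weight q N s *
      (qpoch ((1 / q) ^ s) q k * poly (qfall q N m) ((1 / q) ^ s))) =
    (- 1) ^ k * q ^ (k choose 2) * (qpoch q q N)\<^sup>2 / (qpoch q q (N - k) * qpoch q q (N - m)) *
    qbinom q (N - k + (N - m)) N"
    (is "?L = ?c * _")
proof -
  have "?L = ?c * (\<Sum>s\<le>N. qbinom q (N - k) (N - s) * qbinom q (N - m) s * q ^ (s * (s - k)))"
    unfolding sum_distrib_left by (rule sum.cong) (use qhahn_weight_term[OF q k m] in auto)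
  also have "(\<Sum>s\<le>N. qbinom q (N - k) (N - s) * qbinom q (N - m) s * q ^ (s * (s - k))) =
      (\<Sum>i\<le>N. qbinom q (N - k) i * qbinom q (N - m) (N - i) * q ^ ((N - i) * (N - k - i)))"
    by (rule sum.reindex_bij_witness[of _ "\<lambda>i. N - i" "\<lambda>i. N - i"]) auto
  also have "\<dots> = qbinom q (N - k + (N - m)) N"
    by (rule q_vandermonde[symmetric])
  finally show ?thesis .
qed

text \<open>The coefficient of \<open>(x;q)\<^sub>k\<close> in the hypergeometric sum. All powers of \<open>q\<close> and signs cancel for
  this choice of \<open>\<alpha>\<close> and \<open>\<beta>\<close>, because \<open>\<alpha>\<beta>q\<^bsup>n + 1\<^esup> = q\<^bsup>-(2N + 1 - n)\<^esup>\<close> and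
  \<open>\<alpha>q = q\<^sup>-\<^sup>N\<close>.\<close>

definition qhahn_coeff :: "real \<Rightarrow> nat \<Rightarrow> nat \<Rightarrow> nat \<Rightarrow> real" where
  "qhahn_coeff q N n k = qbinom q n k * qpoch q q (2 * N + 1 - n) * (qpoch q q (N - k))\<^sup>2 /
     (qpoch q q (2 * N + 1 - n - k) * (qpoch q q N)\<^sup>2)"

lemma qhahn_series_symmetric:
  assumes q: "0 < q" "q < 1" and n: "n \<le> N"
  defines "\<alpha> \<equiv> q powi (- int N - 1)"
  shows "qhahn_series q \<alpha> \<alpha> N n =
    (\<Sum>k\<le>n. smult (qhahn_coeff q N n k) (qpoch [:0, 1:] [:q:] k))"
  unfolding qhahn_series_def
proof (rule sum.cong)
  fix k assume "k \<in> {..n}"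
  then have k: "k \<le> n" by simp
  note nz = qpoch_self_nonzero[OF q]
  define a where "a = 2 * N + 1 - n"
  have powi: "q powi (- int j) = (1 / q) ^ j" for j
    by (simp add: power_int_minus power_one_over inverse_eq_divide)
  have \<alpha>: "\<alpha> = (1 / q) ^ Suc N"
    unfolding \<alpha>_def powi[symmetric] by (rule arg_cong[of _ _ "power_int q"]) simp
  have "\<alpha> * \<alpha> * q ^ (n + 1) = (1 / q) ^ a"
  proof -
    have "\<alpha> * \<alpha> = (1 / q) ^ (a + (n + 1))"
      unfolding \<alpha> power_add[symmetric] a_def using n by (intro arg_cong[of _ _ "power (1 / q)"]) simp
    then show ?thesis using q by (simp add: power_add power_one_over)
  qed
  moreover have "\<alpha> * q = (1 / q) ^ N" using q by (simp add: \<alpha>)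
  moreover have "qpoch ((1 / q) ^ n) q k * qpoch ((1 / q) ^ a) q k /
      (qpoch ((1 / q) ^ N) q k * qpoch ((1 / q) ^ N) q k * qpoch q q k) * q ^ k = qhahn_coeff q N n k"
  proof -
    have "n * k + a * k = 2 * (N * k) + k"
      using n by (simp add: a_def add_mult_distrib[symmetric])
    then have e: "q ^ (n * k) * q ^ (a * k) = q ^ (N * k) * q ^ (N * k) * q ^ k"
      by (simp add: power_add[symmetric] mult_2)
    have s: "(-1) ^ k * ((-1) ^ k :: real) = 1" by (simp add: power_add[symmetric])
    define S where "S = (- 1) ^ k * q ^ (k choose 2)"
    have S: "S \<noteq> 0" using q by (simp add: S_def)
    define A where "A = q ^ (N * k)"
    define B where "B = q ^ (n * k)"
    define C where "C = q ^ (a * k)"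
    have nzp: "A \<noteq> 0" "B \<noteq> 0" "C \<noteq> 0" using q by (auto simp: A_def B_def C_def)
    have e': "A * A * q ^ k = B * C" using e by (simp add: A_def B_def C_def)
    have ks: "k \<le> n" "k \<le> a" "k \<le> N" using k n by (auto simp: a_def)
    have E: "qpoch ((1 / q) ^ n) q k = S * qpoch q q n / (B * qpoch q q (n - k))"
      "qpoch ((1 / q) ^ a) q k = S * qpoch q q a / (C * qpoch q q (a - k))"
      "qpoch ((1 / q) ^ N) q k = S * qpoch q q N / (A * qpoch q q (N - k))"
      unfolding S_def A_def B_def C_def
      by (rule qpoch_inverse_power_eq[OF q ks(1)], rule qpoch_inverse_power_eq[OF q ks(2)],
          rule qpoch_inverse_power_eq[OF q ks(3)])
    have "qpoch ((1 / q) ^ n) q k * qpoch ((1 / q) ^ a) q k /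
      (qpoch ((1 / q) ^ N) q k * qpoch ((1 / q) ^ N) q k * qpoch q q k) * q ^ k =
      (A * A * q ^ k) / (B * C) * (qpoch q q n * qpoch q q a * (qpoch q q (N - k))\<^sup>2 /
        (qpoch q q k * qpoch q q (n - k) * (qpoch q q (a - k) * (qpoch q q N)\<^sup>2)))"
      unfolding E using nz S nzp by (simp add: power2_eq_square field_simps)
    also have "\<dots> = qhahn_coeff q N n k"
      unfolding e' using nzp qbinom_eq[OF q k] by (simp add: qhahn_coeff_def a_def)
    finally show ?thesis .
  qed
  ultimately show "smult (qpoch (q powi (- int n)) q k * qpoch (\<alpha> * \<alpha> * q ^ (n + 1)) q k /
      (qpoch (q powi (- int N)) q k * qpoch (\<alpha> * q) q k * qpoch q q k) * q ^ k)
      (qpoch [:0, 1:] [:q:] k) = smult (qhahn_coeff q N n k) (qpoch [:0, 1:] [:q:] k)"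
    unfolding powi by (simp only:)
qed simp

lemma qpoch_indeterminate: "qpoch [:0, 1:] [:q:] k = (\<Prod>i<k. [:1, - (q ^ i):])"
  unfolding qpoch_def by (rule prod.cong) (auto simp: poly_const_pow one_pCons)

lemma poly_qpoch_indeterminate: "poly (qpoch [:0, 1:] [:q:] k) y = qpoch y q k"
  by (simp add: qpoch_indeterminate poly_prod qpoch_def)

lemma degree_qpoch_indeterminate: "q \<noteq> 0 \<Longrightarrow> degree (qpoch [:0, 1:] [:q:] k) = (k :: nat)" for q :: real
  by (simp add: qpoch_indeterminate degree_prod_eq_sum_degree)

lemma qhahn_coeff_nonzero:
  assumes "0 < q" "q < 1" "k \<le> n"
  shows "qhahn_coeff q N n k \<noteq> 0"
  using qpoch_self_nonzero[OF assms(1,2)] qbinom_pos[OF assms(1,3)] by (simp add: qhahn_coeff_def)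

lemma degree_qhahn_series:
  assumes q: "0 < q" "q < 1" and n: "n \<le> N"
  defines "\<alpha> \<equiv> q powi (- int N - 1)"
  shows "degree (qhahn_series q \<alpha> \<alpha> N n) = n" "qhahn_series q \<alpha> \<alpha> N n \<noteq> 0"
proof -
  let ?p = "qhahn_series q \<alpha> \<alpha> N n"
  let ?t = "\<lambda>k. smult (qhahn_coeff q N n k) (qpoch [:0, 1:] [:q:] k)"
  have p: "?p = (\<Sum>k\<le>n. ?t k)"
    unfolding \<alpha>_def by (rule qhahn_series_symmetric[OF q n])
  have t: "degree (?t k) = k" if "k \<le> n" for k
    using q that qhahn_coeff_nonzero[OF q that] by (simp add: degree_qpoch_indeterminate)
  have "coeff ?p n = (\<Sum>k\<le>n. if k = n then coeff (?t n) n else 0)"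
    unfolding p coeff_sum by (rule sum.cong) (use t in \<open>auto simp del: coeff_smult intro!: coeff_eq_0\<close>)
  also have "\<dots> = coeff (?t n) n" by simp
  finally have lc: "coeff ?p n \<noteq> 0"
    using t[of n] qhahn_coeff_nonzero[OF q order_refl] degree_qpoch_indeterminate[of q n] q
    by (metis (no_types, lifting) degree_0 less_irrefl leading_coeff_0_iff order_refl smult_eq_0_iff
        qpoch_0 one_neq_zero)
  have "degree ?p \<le> n"
    unfolding p by (rule degree_sum_le) (use t in auto)
  then show "degree ?p = n" "?p \<noteq> 0" using lc le_degree[OF lc] by auto
qed

lemma sum_poly_basis_eq_0:
  fixes v x :: "nat \<Rightarrow> real"
  assumes deg: "\<And>m. m < n \<Longrightarrow> degree (B m) = m" "\<And>m. m < n \<Longrightarrow> B m \<noteq> 0"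
    and zero: "\<And>m. m < n \<Longrightarrow> (\<Sum>s\<le>N. v s * poly (B m) (x s)) = 0" and r: "degree r < n"
  shows "(\<Sum>s\<le>N. v s * poly r (x s)) = 0"
  using r
proof (induction "degree r" arbitrary: r rule: less_induct)
  case less
  define m where "m = degree r"
  define c where "c = lead_coeff r / lead_coeff (B m)"
  define d where "d = r - smult c (B m)"
  have m: "m < n" using less.prems by (simp add: m_def)
  have B: "degree (B m) = m" "coeff (B m) m \<noteq> 0"
    using deg[OF m] leading_coeff_0_iff by (metis, metis)
  have "degree d \<le> m" "coeff d m = 0"
    using B by (auto simp: d_def c_def m_def intro: degree_diff_le order.trans[OF degree_smult_le])
  have "(\<Sum>s\<le>N. v s * poly d (x s)) = 0"
  proof (cases "d = 0")
    case False
    then have "degree d < m"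
      using \<open>degree d \<le> m\<close> \<open>coeff d m = 0\<close> by (metis le_neq_implies_less leading_coeff_0_iff)
    then show ?thesis using less.hyps[of d] m by (simp add: m_def)
  qed simp
  moreover have "(\<Sum>s\<le>N. v s * poly r (x s)) =
      (\<Sum>s\<le>N. v s * poly d (x s)) + c * (\<Sum>s\<le>N. v s * poly (B m) (x s))"
    by (simp add: d_def algebra_simps sum_subtractf sum.distrib sum_distrib_left)
  ultimately show ?case using zero[OF m] by simp
qed

text \<open>Apart from the weights of the alternating \<open>q\<close>-binomial sum, the dependence on \<open>k\<close> is a polynomial in
  \<open>q\<^sup>-\<^sup>k\<close> of degree \<open>n - 1\<close>. Its second factor is \<open>(q;q)\<^bsub>2N-k-m\<^esub> / (q;q)\<^bsub>2N+1-n-k\<^esub>\<close>; this is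
  where \<open>m < n\<close> enters, since otherwise the quotient is not a polynomial.\<close>

lemma qhahn_coeff_moment:
  assumes q: "0 < q" "q < 1" and n: "n \<le> N" and m: "m < n" and k: "k \<le> n"
  shows "qhahn_coeff q N n k * ((- 1) ^ k * q ^ (k choose 2) * (qpoch q q N)\<^sup>2 /
      (qpoch q q (N - k) * qpoch q q (N - m)) * qbinom q (N - k + (N - m)) N) =
    qpoch q q (2 * N + 1 - n) / (qpoch q q N * qpoch q q (N - m)) *
    ((- 1) ^ k * q ^ (k choose 2) * qbinom q n k *
      poly (qfall q N m * qfall q (2 * N - m) (n - 1 - m)) ((1 / q) ^ k))"
proof (cases "k + m \<le> N")
  case True
  note nz = qpoch_self_nonzero[OF q]
  have 1: "poly (qfall q N m) ((1 / q) ^ k) = qpoch q q (N - k) / qpoch q q (N - k - m)"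
    using poly_qfall[of q k m N] True q nz by (simp add: field_simps)
  have e: "2 * N - m - k = N - k + (N - m)"
      "N - k + (N - m) - (n - 1 - m) = 2 * N + 1 - n - k" "k + (n - 1 - m) \<le> 2 * N - m"
    using n m k True by auto
  have "poly (qfall q (2 * N - m) (n - 1 - m)) ((1 / q) ^ k) * qpoch q q (2 * N + 1 - n - k) =
      qpoch q q (N - k + (N - m))"
    using poly_qfall[OF _ e(3), of q] q unfolding e by simp
  then have 2: "poly (qfall q (2 * N - m) (n - 1 - m)) ((1 / q) ^ k) =
      qpoch q q (N - k + (N - m)) / qpoch q q (2 * N + 1 - n - k)"
    using nz by (simp add: field_simps)
  have "N - k + (N - m) - N = N - k - m" using True by simp
  then have 3: "qbinom q (N - k + (N - m)) N =
      qpoch q q (N - k + (N - m)) / (qpoch q q N * qpoch q q (N - k - m))"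
    using qbinom_eq[OF q, of N "N - k + (N - m)"] True by simp
  show ?thesis
    unfolding poly_mult 1 2 3 qhahn_coeff_def using nz by (simp add: field_simps power2_eq_square)
next
  case False
  then have "qbinom q (N - k + (N - m)) N = 0" using n m k by (intro qbinom_eq_0) simp
  moreover have "poly (qfall q N m) ((1 / q) ^ k) = 0"
    using False q n k by (intro poly_qfall_eq_0) auto
  ultimately show ?thesis by simp
qed

lemma qhahn_series_orth:
  assumes q: "0 < q" "q < 1" and n: "n \<le> N"
  defines "\<alpha> \<equiv> q powi (- int N - 1)"
  shows "orth_below (qhahn_weight q N) (\<lambda>s. (1 / q) ^ s) N n (qhahn_series q \<alpha> \<alpha> N n)"
  unfolding orth_below_def
proof (intro allI impI)
  fix r :: "real poly" assume r: "degree r < n"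
  let ?x = "\<lambda>s. (1 / q) ^ s"
  let ?p = "qhahn_series q \<alpha> \<alpha> N n"
  let ?w = "qhahn_weight q N"
  have p: "poly ?p y = (\<Sum>k\<le>n. qhahn_coeff q N n k * qpoch y q k)" for y
    unfolding \<alpha>_def qhahn_series_symmetric[OF q n] by (simp add: poly_sum poly_qpoch_indeterminate)
  have "(\<Sum>s\<le>N. ?w s * poly ?p (?x s) * poly r (?x s)) = 0"
  proof (rule sum_poly_basis_eq_0[where B = "qfall q N" and x = ?x and v = "\<lambda>s. ?w s * poly ?p (?x s)", OF _ _ _ r])
    fix m assume m: "m < n"
    show "degree (qfall q N m) = m"
      using q by (simp add: degree_qfall)
    show "qfall q N m \<noteq> 0"
      by (simp add: qfall_def)
    let ?g = "qfall q N m * qfall q (2 * N - m) (n - 1 - m)"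
    have q0: "q \<noteq> 0" using q by simp
    have deg_g: "degree ?g < n"
      using degree_mult_le[of "qfall q N m" "qfall q (2 * N - m) (n - 1 - m)"] m q
      by (simp add: degree_qfall)
    have "(\<Sum>s\<le>N. ?w s * poly ?p (?x s) * poly (qfall q N m) (?x s)) =
        (\<Sum>k\<le>n. qhahn_coeff q N n k *
          (\<Sum>s\<le>N. ?w s * (qpoch (?x s) q k * poly (qfall q N m) (?x s))))"
      unfolding p sum_distrib_left sum_distrib_right by (subst sum.swap) (simp add: mult_ac)
    also have "\<dots> = (\<Sum>k\<le>n. qpoch q q (2 * N + 1 - n) / (qpoch q q N * qpoch q q (N - m)) *
        ((- 1) ^ k * q ^ (k choose 2) * qbinom q n k * poly ?g ((1 / q) ^ k)))"
    proof (rule sum.cong)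
      fix k assume "k \<in> {..n}"
      then show "qhahn_coeff q N n k *
          (\<Sum>s\<le>N. ?w s * (qpoch (?x s) q k * poly (qfall q N m) (?x s))) =
        qpoch q q (2 * N + 1 - n) / (qpoch q q N * qpoch q q (N - m)) *
        ((- 1) ^ k * q ^ (k choose 2) * qbinom q n k * poly ?g ((1 / q) ^ k))"
        using qhahn_weight_moment[OF q, of k N m] qhahn_coeff_moment[OF q n m, of k] n m by simp
    qed simp
    also have "\<dots> = 0"
      unfolding sum_distrib_left[symmetric] qbinom_alternating_poly_sum[OF q0 deg_g] by simp
    finally show "(\<Sum>s\<le>N. ?w s * poly ?p (?x s) * poly (qfall q N m) (?x s)) = 0" by simp
  qed
  then show "(\<Sum>s\<le>N. ?w s * poly (?p * r) (?x s)) = 0" by (simp add: mult_ac)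
qed

lemma monic_orth_monic_qhahn:
  assumes q: "0 < q" "q < 1" and n: "n \<le> N + 1"
  defines "\<alpha> \<equiv> q powi (- int N - 1)"
  shows "monic_orth (qhahn_weight q N) (\<lambda>s. (1 / q) ^ s) N n (monic_qhahn q \<alpha> \<alpha> N n)"
proof (cases "n \<le> N")
  case True
  let ?p = "qhahn_series q \<alpha> \<alpha> N n"
  let ?c = "inverse (lead_coeff ?p)"
  have p: "degree ?p = n" "?p \<noteq> 0"
    unfolding \<alpha>_def using degree_qhahn_series[OF q True] by auto
  have "orth_below (qhahn_weight q N) (\<lambda>s. (1 / q) ^ s) N n (smult ?c ?p)"
    unfolding orth_below_def
  proof (intro allI impI)
    fix r :: "real poly" assume r: "degree r < n"
    have "(\<Sum>s\<le>N. qhahn_weight q N s * poly (smult ?c ?p * r) ((1 / q) ^ s)) =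
        ?c * (\<Sum>s\<le>N. qhahn_weight q N s * poly (?p * r) ((1 / q) ^ s))"
      unfolding sum_distrib_left by (simp add: mult_ac)
    also have "\<dots> = 0"
      using orth_belowD[OF qhahn_series_orth[OF q True] r] by (simp add: \<alpha>_def)
    finally show "(\<Sum>s\<le>N. qhahn_weight q N s * poly (smult ?c ?p * r) ((1 / q) ^ s)) = 0" .
  qed
  then show ?thesis
    using True p leading_coeff_0_iff[of ?p] by (simp add: monic_orth_def monic_qhahn_def make_monic_def)
next
  case False
  then have [simp]: "n = Suc N" using n by simp
  have "(\<lambda>s. q powi (- int s)) = (\<lambda>s. (1 / q) ^ s)"
    by (simp add: power_int_minus power_one_over inverse_eq_divide)
  then show ?thesis
    using degree_grid_poly[of "\<lambda>s. (1 / q) ^ s" N] monic_grid_poly[of "\<lambda>s. (1 / q) ^ s" N]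
      poly_grid_poly[of _ N "\<lambda>s. (1 / q) ^ s"]
    by (simp add: monic_orth_def orth_below_def monic_qhahn_def)
qed

section \<open>The derivative of the grid polynomial on the exponential grid\<close>

text \<open>A factor with \<open>j < s\<close> equals \<open>q\<^sup>-\<^sup>s (1 - q\<^bsup>s - j\<^esup>)\<close>, one with \<open>j > s\<close> equals
  \<open>- q\<^sup>-\<^sup>j (1 - q\<^bsup>j - s\<^esup>)\<close>; the product of the \<open>q\<^sup>j\<close> over \<open>j > s\<close> is left
  unevaluated, because it simplifies only together with the one over \<open>j \<le> s\<close>.\<close>

lemma pderiv_grid_poly_exponential:
  assumes q: "0 < q" "q < 1" and s: "s \<le> N"
  shows "poly (pderiv (grid_poly (\<lambda>s. (1 / q) ^ s) N)) ((1 / q) ^ s) *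
      (q ^ (s * s) * (\<Prod>j\<in>{s<..N}. q ^ j)) =
    (- 1) ^ (N - s) * (qpoch q q s * qpoch q q (N - s))"
proof -
  have below: "(\<Prod>j<t. (1 / q) ^ s - (1 / q) ^ j) * (q ^ (s * t) * qpoch q q (s - t)) = qpoch q q s"
    if "t \<le> s" for t
    using that
  proof (induction t)
    case (Suc t)
    have t: "s - t = Suc (s - Suc t)" using Suc.prems by simp
    have "s = t + Suc (s - Suc t)" using Suc.prems by simp
    then have "q ^ s = q ^ t * q ^ Suc (s - Suc t)" by (metis power_add)
    then have "((1 / q) ^ s - (1 / q) ^ t) * q ^ s = 1 - q ^ Suc (s - Suc t)"
      using q by (simp add: power_one_over algebra_simps)
    note step_t = this
    have "(\<Prod>j<Suc t. (1 / q) ^ s - (1 / q) ^ j) * (q ^ (s * Suc t) * qpoch q q (s - Suc t)) =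
        (\<Prod>j<t. (1 / q) ^ s - (1 / q) ^ j) *
        (q ^ (s * t) * (qpoch q q (s - Suc t) * (1 - q ^ Suc (s - Suc t))))"
      unfolding step_t[symmetric] by (simp add: power_add mult_ac)
    also have "\<dots> = qpoch q q s"
      using Suc t qpoch_self_Suc[of q "s - Suc t"] by simp
    finally show ?case .
  qed simp
  have above: "(\<Prod>j\<in>{s<..s + t}. (1 / q) ^ s - (1 / q) ^ j) * (\<Prod>j\<in>{s<..s + t}. q ^ j) =
      (- 1) ^ t * qpoch q q t" for t
  proof (induction t)
    case (Suc t)
    have set: "{s<..s + Suc t} = insert (s + Suc t) {s<..s + t}" by auto
    have "((1 / q) ^ s - (1 / q) ^ (s + Suc t)) * q ^ (s + Suc t) = - (1 - q ^ Suc t)"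
      using q by (simp add: power_add power_one_over field_simps)
    moreover have "(\<Prod>j\<in>{s<..s + Suc t}. (1 / q) ^ s - (1 / q) ^ j) * (\<Prod>j\<in>{s<..s + Suc t}. q ^ j) =
        ((1 / q) ^ s - (1 / q) ^ (s + Suc t)) * q ^ (s + Suc t) *
        ((\<Prod>j\<in>{s<..s + t}. (1 / q) ^ s - (1 / q) ^ j) * (\<Prod>j\<in>{s<..s + t}. q ^ j))"
      unfolding set by (simp del: power_Suc add_Suc_right add: mult_ac)
    ultimately show ?case
      unfolding Suc.IH by (simp only: qpoch_self_Suc) (simp add: algebra_simps)
  qed simp
  have split: "{..N} - {s} = {..<s} \<union> {s<..N}" using s by auto
  have factors: "poly (pderiv (grid_poly (\<lambda>s. (1 / q) ^ s) N)) ((1 / q) ^ s) =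
      (\<Prod>j<s. (1 / q) ^ s - (1 / q) ^ j) * (\<Prod>j\<in>{s<..N}. (1 / q) ^ s - (1 / q) ^ j)"
    unfolding poly_pderiv_grid_poly[OF s, of "\<lambda>s. (1 / q) ^ s"] split
    by (rule prod.union_disjoint) auto
  show ?thesis
  proof -
    let ?l = "\<Prod>j<s. (1 / q) ^ s - (1 / q) ^ j"
    let ?r = "\<Prod>j\<in>{s<..N}. (1 / q) ^ s - (1 / q) ^ j"
    have "(?l * q ^ (s * s)) * (?r * (\<Prod>j\<in>{s<..N}. q ^ j)) =
        qpoch q q s * ((- 1) ^ (N - s) * qpoch q q (N - s))"
      using below[of s] above[of "N - s"] s by simp
    then show ?thesis unfolding factors by (simp add: mult_ac)
  qed
qed

lemma prod_power_atMost_square: "(\<Prod>j\<le>s. q ^ j)\<^sup>2 = (q::real) ^ (s * Suc s)"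
  by (induction s) (auto simp: power_mult_distrib power2_eq_square power_add[symmetric] algebra_simps)

text \<open>The powers of \<open>q\<close> combine to a constant since \<open>q\<^bsup>s(s+1)\<^esup>\<close> is the square of the product of
  \<open>q\<^sup>j\<close> over \<open>j \<le> s\<close>, which completes the product over \<open>s < j \<le> N\<close> from the derivative to
  one over the whole grid.\<close>

lemma christoffel_weight:
  assumes q: "0 < q" "q < 1" and s: "s \<le> N"
  shows "(qhahn_weight q N s * (1 / q) ^ s) *
      (poly (pderiv (grid_poly (\<lambda>s. (1 / q) ^ s) N)) ((1 / q) ^ s))\<^sup>2 =
    (qpoch q q N)\<^sup>2 / q ^ (N * Suc N)"
proof -
  define d where "d = poly (pderiv (grid_poly (\<lambda>s. (1 / q) ^ s) N)) ((1 / q) ^ s)"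
  define E where "E = (\<Prod>j\<in>{s<..N}. q ^ j)"
  define f where "f = qpoch q q s * qpoch q q (N - s)"
  have E: "E \<noteq> 0" using q by (simp add: E_def)
  have "(d * (q ^ (s * s) * E))\<^sup>2 = f\<^sup>2"
    using pderiv_grid_poly_exponential[OF q s]
    by (simp add: d_def E_def f_def power_mult_distrib power_mult[symmetric] mult.commute[of _ 2])
  then have d: "d\<^sup>2 = f\<^sup>2 / (q ^ (s * s) * E)\<^sup>2"
    using E q by (simp add: field_simps power_mult_distrib)
  have "{..N} = {..s} \<union> {s<..N}" using s by auto
  then have "(\<Prod>j\<le>N. q ^ j) = (\<Prod>j\<le>s. q ^ j) * E"
    by (simp add: E_def prod.union_disjoint[symmetric] ivl_disj_int)
  then have E2: "q ^ (N * Suc N) = q ^ (s * Suc s) * E\<^sup>2"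
    by (simp only: prod_power_atMost_square[symmetric] power_mult_distrib)
  have b: "(qpoch q q N)\<^sup>2 = (qbinom q N s)\<^sup>2 * f\<^sup>2"
    using qbinom_times_qpoch[OF s, of q] by (simp add: f_def power_mult_distrib[symmetric])
  show ?thesis
    unfolding d_def[symmetric] d E2 b qhahn_weight_def
    using E q by (simp add: power_one_over power2_eq_square power_add field_simps)
qed

theorem proposition6:
  fixes q :: real and N :: nat and P Q :: "nat \<Rightarrow> real poly"
  assumes "0 < q" and "q < 1" and "N \<ge> 1"
  defines "P \<equiv> sturmian (\<lambda>s. q powi (- int s)) N"
    and "Q \<equiv> monic_qhahn q (q powi (- int N - 1)) (q powi (- int N - 1)) N"
  shows "\<forall>n\<le>N. poly (Q n) 0 \<noteq> 0 \<and> P n = christoffel_transform Q 0 n"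
proof (intro allI impI)
  fix n assume n: "n \<le> N"
  let ?x = "\<lambda>s. (1 / q) ^ s"
  let ?w = "qhahn_weight q N"
  note q = \<open>0 < q\<close> \<open>q < 1\<close>
  have x_eq: "(\<lambda>s. q powi (- int s)) = ?x"
    by (simp add: power_int_minus power_one_over inverse_eq_divide)
  have inj: "inj_on ?x {..N}"
    using q by (auto simp: inj_on_def intro: power_inject_exp[THEN iffD1, of "1 / q"])
  have w: "?w s > 0" if "s \<le> N" for s
    using qbinom_pos[OF q(1) that] q by (simp add: qhahn_weight_def)
  have x: "?x s > 0" for s using q by simp
  have Q: "monic_orth ?w ?x N m (Q m)" if "m \<le> N + 1" for m
    unfolding Q_def by (rule monic_orth_monic_qhahn[OF q that])
  have "poly (Q n) 0 \<noteq> 0"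
    using n by (intro monic_orth_nonzero_at_0[where w = ?w, OF inj w x Q]) auto
  moreover have "P n = christoffel_transform Q 0 n"
    unfolding P_def x_eq
  proof (rule sturmian_eq_monic_orth[where w = "\<lambda>s. ?w s * ?x s", OF inj _ christoffel_weight[OF q] _ n])
    show "monic_orth (\<lambda>s. ?w s * ?x s) ?x N m (christoffel_transform Q 0 m)" if "m \<le> N" for m
      using that by (intro monic_orth_christoffel_transform[where w = ?w, OF inj w x Q Q]) auto
  qed (use w x in auto)
  ultimately show "poly (Q n) 0 \<noteq> 0 \<and> P n = christoffel_transform Q 0 n" by simp
qed

end
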